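(* Let $(V,* )$ be a finite travel groupoid with $|V|>1$. Then the following statements are equivalent: (1) $(V,* )$ is on a complete bipartite graph (i.e. its associated graph $G_V$ is a complete bipartite graph); (2) for all pairwise distinct $u,v,w\in V$, if $v*w=w$, then exactly one of $v*u=u$ and $w*u=u$ holds.
   Context: A groupoid $(V,* )$ is a nonempty set $V$ with a binary operation $*:V\times V\to V$. It is a travel groupoid if (t1) $(u*v)*u=u$ for all $u,v\in V$, and (t2) for all $u,v\in V$, if $(u*v)*v=u$ then $u=v$. The associated graph $G_V$ of a travel groupoid has vertex set $V$ and edge set $\{\{u,v\} : u,v\in V,\ u\neq u*v=v\}$; $(V,* )$ is said to be on a graph $G$ if $G=G_V$. Graphs are finite, undirected, with no multiple edges or loops. A complete bipartite graph is a graph whose vertex set is partitioned into two nonempty independent sets $V_1,V_2$, with an edge between every vertex of $V_1$ and every vertex of $V_2$. *)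

theory Defs imports Main begin

locale groupoid =
  fixes V :: "'a set" and op :: "'a \<Rightarrow> 'a \<Rightarrow> 'a" (infixl "\<star>" 70)
  assumes nonempty: "V \<noteq> {}"
    and closed: "u \<in> V \<Longrightarrow> v \<in> V \<Longrightarrow> u \<star> v \<in> V"

locale travel_groupoid = groupoid +
  assumes t1: "u \<in> V \<Longrightarrow> v \<in> V \<Longrightarrow> (u \<star> v) \<star> u = u"
    and t2: "u \<in> V \<Longrightarrow> v \<in> V \<Longrightarrow> (u \<star> v) \<star> v = u \<Longrightarrow> u = v"

text \<open>A graph is a pair of a vertex set and a set of edges, the edges being two-element vertex sets.\<close>

type_synonym 'a graph = "'a set \<times> 'a set set"

abbreviation verts :: "'a graph \<Rightarrow> 'a set" where "verts \<equiv> fst"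
abbreviation edges :: "'a graph \<Rightarrow> 'a set set" where "edges \<equiv> snd"

definition simple_graph :: "'a graph \<Rightarrow> bool" where
  "simple_graph G \<longleftrightarrow> finite (verts G) \<and> (\<forall>e \<in> edges G. e \<subseteq> verts G \<and> card e = 2)"

definition independent_in :: "'a graph \<Rightarrow> 'a set \<Rightarrow> bool" where
  "independent_in G S \<longleftrightarrow> S \<subseteq> verts G \<and> (\<forall>u\<in>S. \<forall>v\<in>S. {u, v} \<notin> edges G)"

definition complete_bipartite :: "'a graph \<Rightarrow> bool" where
  "complete_bipartite G \<longleftrightarrow> simple_graph G \<and>
    (\<exists>V1 V2. V1 \<noteq> {} \<and> V2 \<noteq> {} \<and> V1 \<inter> V2 = {} \<and> V1 \<union> V2 = verts G \<and>
      independent_in G V1 \<and> independent_in G V2 \<and>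
      (\<forall>u\<in>V1. \<forall>v\<in>V2. {u, v} \<in> edges G))"

definition assoc_graph :: "'a set \<Rightarrow> ('a \<Rightarrow> 'a \<Rightarrow> 'a) \<Rightarrow> 'a graph" where
  "assoc_graph V op = (V, {{u, v} | u v. u \<in> V \<and> v \<in> V \<and> u \<noteq> op u v \<and> op u v = v})"

definition groupoid_on :: "'a set \<Rightarrow> ('a \<Rightarrow> 'a \<Rightarrow> 'a) \<Rightarrow> 'a graph \<Rightarrow> bool" where
  "groupoid_on V op G \<longleftrightarrow> G = assoc_graph V op"

end

(* By (t1), u * v = v is a symmetric relation; if u and v differ, then u * v is
   a neighbour of u, so the associated graph has an edge v w. Condition (2) says that every vertex
   off an edge is adjacent to exactly one of its ends, so the neighbourhoods of w and v partition V;
   applying (2) to edges at v or w shows that these are the sides of a complete bipartite graph. *)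
theory Submission imports Defs begin

context travel_groupoid
begin

lemma adj_sym:
  assumes "u \<in> V" "v \<in> V" "u \<star> v = v"
  shows "v \<star> u = u"
  using t1[of u v] assms by simp

text \<open>If the first step stayed at \<open>u\<close>, then so would a second step towards
  \<open>v\<close>, and (t2) would force \<open>u = v\<close>.\<close>

lemma first_step_neq:
  assumes "u \<in> V" "v \<in> V" "u \<noteq> v"
  shows "u \<star> v \<noteq> u"
  using t2[of u v] assms by auto

text \<open>Read from the far end, (t1) says that \<open>u \<star> v\<close> steps directly to
  \<open>u\<close>; \<open>adj_sym\<close> reverses this step.\<close>

lemma first_step_adj:
  assumes "u \<in> V" "v \<in> V"
  shows "u \<star> (u \<star> v) = u \<star> v"
  using adj_sym[of "u \<star> v" u] t1[of u v] closed[of u v] assms by simp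

text \<open>An edge is an unordered pair, so \<open>{u, v}\<close> may arise from either
  orientation; \<open>adj_sym\<close> makes the choice irrelevant.\<close>

lemma edge_iff:
  "{u, v} \<in> edges (assoc_graph V (\<star>)) \<longleftrightarrow> u \<in> V \<and> v \<in> V \<and> u \<noteq> v \<and> u \<star> v = v"
proof
  assume "{u, v} \<in> edges (assoc_graph V (\<star>))"
  then obtain a b where "{u, v} = {a, b}" "a \<in> V" "b \<in> V" "a \<noteq> a \<star> b" "a \<star> b = b"
    by (auto simp: assoc_graph_def)
  then show "u \<in> V \<and> v \<in> V \<and> u \<noteq> v \<and> u \<star> v = v"
    using adj_sym[of a b] by (auto simp: doubleton_eq_iff)
next
  assume "u \<in> V \<and> v \<in> V \<and> u \<noteq> v \<and> u \<star> v = v"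
  then show "{u, v} \<in> edges (assoc_graph V (\<star>))"
    unfolding assoc_graph_def by fastforce
qed

lemma simple_assoc_graph:
  assumes "finite V"
  shows "simple_graph (assoc_graph V (\<star>))"
  using assms by (auto simp: simple_graph_def assoc_graph_def)

end

theorem theorem4p5:
  fixes V :: "'a set" and op :: "'a \<Rightarrow> 'a \<Rightarrow> 'a" (infixl "\<star>" 70)
  assumes "travel_groupoid V (\<star>)" and "finite V" and "card V > 1"
  shows "(\<exists>G. complete_bipartite G \<and> groupoid_on V (\<star>) G) \<longleftrightarrow>
    (\<forall>u\<in>V. \<forall>v\<in>V. \<forall>w\<in>V. u \<noteq> v \<and> u \<noteq> w \<and> v \<noteq> w \<and> v \<star> w = w \<longrightarrow>
      (v \<star> u = u \<and> w \<star> u \<noteq> u) \<or> (v \<star> u \<noteq> u \<and> w \<star> u = u))"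
    (is "?L \<longleftrightarrow> ?R")
proof -
  interpret travel_groupoid V "(\<star>)" by fact
  let ?G = "assoc_graph V (\<star>)"
  have verts: "verts ?G = V"
    by (simp add: assoc_graph_def)
  show ?thesis
  proof
    assume ?L
    then have "complete_bipartite ?G"
      by (auto simp: groupoid_on_def)
    then obtain A B where AB: "A \<union> B = V"
      and A: "independent_in ?G A" and B: "independent_in ?G B"
      and cross: "\<forall>u\<in>A. \<forall>v\<in>B. {u, v} \<in> edges ?G"
      unfolding complete_bipartite_def verts by (elim conjE exE)
    note indep = A[unfolded independent_in_def] B[unfolded independent_in_def]
    show ?R
    proof (intro ballI impI)
      fix u v w
      assume V: "u \<in> V" "v \<in> V" "w \<in> V"
        and h: "u \<noteq> v \<and> u \<noteq> w \<and> v \<noteq> w \<and> v \<star> w = w"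
      then have "{v, w} \<in> edges ?G"
        by (simp add: edge_iff)
      \<comment> \<open>Independence puts \<open>v\<close> and \<open>w\<close> on opposite sides,
        and \<open>u\<close> is adjacent to the end on the side not containing it.\<close>
      then have "{v, u} \<in> edges ?G \<longleftrightarrow> {w, u} \<notin> edges ?G"
        using V AB indep cross by (metis UnE insert_commute)
      then show "(v \<star> u = u \<and> w \<star> u \<noteq> u) \<or> (v \<star> u \<noteq> u \<and> w \<star> u = u)"
        using V h by (auto simp: edge_iff)
    qed
  next
    assume R: ?R
    define E where "E u v \<longleftrightarrow> u \<in> V \<and> v \<in> V \<and> u \<noteq> v \<and> u \<star> v = v" for u v
    have sym: "E u v \<Longrightarrow> E v u" for u v
      using adj_sym[of u v] by (auto simp: E_def)
    have edge: "{u, v} \<in> edges ?G \<longleftrightarrow> E u v" for u v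
      by (simp add: edge_iff E_def)
    have irrefl: "\<not> E u u" for u
      by (simp add: E_def)
    \<comment> \<open>This extends condition (2) to \<open>u = v\<close> and \<open>u = w\<close>,
      where symmetry and irreflexivity of \<open>E\<close> decide.\<close>
    have one: "E v u \<longleftrightarrow> \<not> E w u" if "E v w" "u \<in> V" for u v w
      using R that sym[OF that(1)] irrefl by (cases "u = v \<or> u = w") (auto simp: E_def)
    obtain x y where "x \<in> V" "y \<in> V" "x \<noteq> y"
      using \<open>card V > 1\<close> \<open>finite V\<close> by (metis card_le_Suc0_iff_eq not_le One_nat_def)
    \<comment> \<open>The vertices \<open>x\<close> and \<open>y\<close> need not be adjacent, but
      the first step from \<open>x\<close> towards \<open>y\<close> ends at a neighbour of
      \<open>x\<close>.\<close>
    then have "E x (x \<star> y)"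
      using first_step_neq[of x y] first_step_adj[of x y] closed[of x y] by (simp add: E_def)
    then obtain v w where vw: "E v w" ..
    \<comment> \<open>Neighbourhoods are crossed: \<open>A\<close> contains \<open>v\<close> and
      \<open>B\<close> contains \<open>w\<close>.\<close>
    define A B where "A = {u. E w u}" and "B = {u. E v u}"
    have sub: "A \<subseteq> V" "B \<subseteq> V"
      by (auto simp: A_def B_def E_def)
    have "A \<noteq> {}" "B \<noteq> {}"
      using vw sym[OF vw] by (auto simp: A_def B_def)
    moreover have "A \<inter> B = {}" "A \<union> B = V"
      using one[OF vw] sub by (auto simp: A_def B_def)
    \<comment> \<open>Both \<open>a\<close> and \<open>b\<close> are adjacent to a common end
      \<open>c\<close> (\<open>w\<close> for \<open>A\<close>, \<open>v\<close> for
      \<open>B\<close>); \<open>one\<close> for the edge from \<open>c\<close> to \<open>a\<close>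
      excludes \<open>E a b\<close>.\<close>
    moreover have "\<not> E a b" if "a \<in> A \<and> b \<in> A \<or> a \<in> B \<and> b \<in> B" for a b
      using that one[of _ a b] sub sym unfolding A_def B_def by blast
    \<comment> \<open>Since \<open>E v b\<close>, the edge from \<open>v\<close> to \<open>w\<close>
      gives \<open>\<not> E w b\<close>; the edge from \<open>w\<close> to \<open>a\<close> then
      yields \<open>E a b\<close>.\<close>
    moreover have "E a b" if "a \<in> A" "b \<in> B" for a b
      using that one[of w a b] one[OF vw, of b] sub unfolding A_def B_def by blast
    ultimately have "complete_bipartite ?G"
      using simple_assoc_graph[OF \<open>finite V\<close>]
      unfolding complete_bipartite_def independent_in_def verts edge
      using sub by (intro conjI exI[of _ A] exI[of _ B]) simp_all
    then show ?L
      unfolding groupoid_on_def by blast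
  qed
qed

end
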